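(* No proper ideal has complementation constant or separable-injectivity constant strictly smaller than $2$; that is, for every proper ideal $\mathcal I$ on $\omega$, $\lambda_{\mathrm{comp}}(c_{0,\mathcal I})\ge 2$ and $\lambda_{\mathrm{si}}(c_{0,\mathcal I})\ge2$.
   Context: An ideal on $\omega$ is a collection of subsets of $\omega$ containing $\emptyset$, closed under subsets and finite unions; every ideal is assumed to contain all finite sets; it is proper if it is not $\mathcal P(\omega)$. $c_{0,\mathcal I}$ is the closed subspace of $\ell_\infty$ (sup norm) of all bounded scalar sequences $(x_n)$ with $\{n:|x_n|\ge\varepsilon\}\in\mathcal I$ for every $\varepsilon>0$. For a closed subspace $Y$ of $\ell_\infty$, $\lambda_{\mathrm{comp}}(Y)=\inf\{\|P\|: P\colon\ell_\infty\to Y\text{ is a bounded linear projection onto }Y\}$, the infimum being in the extended reals (so it is $\infty$ if there is no projection). For a Banach space $X$, $\lambda_{\mathrm{si}}(X)$ is the infimum (in the extended reals) of all $\lambda>0$ such that for every separable Banach space $E$, every closed subspace $F$ of $E$ and every bounded operator $T\colon F\to X$ there is a bounded operator $\widetilde T\colon E\to X$ with $\widetilde T|_F=T$ and $\|\widetilde T\|\le\lambda\|T\|$. The complementation and separable-injectivity constants of an ideal $\mathcal I$ are $\lambda_{\mathrm{comp}}(c_{0,\mathcal I})$ and $\lambda_{\mathrm{si}}(c_{0,\mathcal I})$. *)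

theory Defs
  imports "HOL-Analysis.Analysis"
begin

section \<open>Normed spaces on explicit carriers\<close>

text \<open>
  The constant \<open>si_const\<close> below quantifies over all separable Banach spaces inside a definition, so
  Banach spaces are structures on carrier sets rather than types of class \<open>banach\<close>.

  The scalar field is any type \<open>'k\<close> of class \<open>real_normed_field\<close>; by the Gelfand-Mazur theorem such a
  field is isometrically isomorphic to the real or to the complex numbers. Linearity means linearity
  over \<open>'k\<close>.
\<close>

record ('k, 'e) nvs =
  vcar :: "'e set"
  vadd :: "'e \<Rightarrow> 'e \<Rightarrow> 'e"
  vzero :: 'e
  vscale :: "'k \<Rightarrow> 'e \<Rightarrow> 'e"
  vnorm :: "'e \<Rightarrow> real"

locale normed_space =
  fixes E :: "('k::real_normed_field, 'e) nvs"
  assumes zero_closed: "vzero E \<in> vcar E"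
    and add_closed: "\<lbrakk>x \<in> vcar E; y \<in> vcar E\<rbrakk> \<Longrightarrow> vadd E x y \<in> vcar E"
    and scale_closed: "x \<in> vcar E \<Longrightarrow> vscale E a x \<in> vcar E"
    and add_assoc: "\<lbrakk>x \<in> vcar E; y \<in> vcar E; z \<in> vcar E\<rbrakk>
          \<Longrightarrow> vadd E (vadd E x y) z = vadd E x (vadd E y z)"
    and add_commute: "\<lbrakk>x \<in> vcar E; y \<in> vcar E\<rbrakk> \<Longrightarrow> vadd E x y = vadd E y x"
    and add_zero: "x \<in> vcar E \<Longrightarrow> vadd E x (vzero E) = x"
    and add_inverse: "x \<in> vcar E \<Longrightarrow> \<exists>y\<in>vcar E. vadd E x y = vzero E"
    and scale_add_right: "\<lbrakk>x \<in> vcar E; y \<in> vcar E\<rbrakk>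
          \<Longrightarrow> vscale E a (vadd E x y) = vadd E (vscale E a x) (vscale E a y)"
    and scale_add_left: "x \<in> vcar E
          \<Longrightarrow> vscale E (a + b) x = vadd E (vscale E a x) (vscale E b x)"
    and scale_scale: "x \<in> vcar E \<Longrightarrow> vscale E a (vscale E b x) = vscale E (a * b) x"
    and scale_one: "x \<in> vcar E \<Longrightarrow> vscale E 1 x = x"
    and norm_eq_0: "x \<in> vcar E \<Longrightarrow> vnorm E x = 0 \<longleftrightarrow> x = vzero E"
    and norm_scale: "x \<in> vcar E \<Longrightarrow> vnorm E (vscale E a x) = norm a * vnorm E x"
    and norm_triangle: "\<lbrakk>x \<in> vcar E; y \<in> vcar E\<rbrakk>
          \<Longrightarrow> vnorm E (vadd E x y) \<le> vnorm E x + vnorm E y"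

text \<open>
  The value off the carrier is immaterial; \<open>0\<close> is chosen because \<open>Metric_space\<close> requires distances to
  be symmetric and non-negative on the whole type.
\<close>

definition vdist :: "('k::real_normed_field, 'e) nvs \<Rightarrow> 'e \<Rightarrow> 'e \<Rightarrow> real" where
  "vdist E x y =
     (if x \<in> vcar E \<and> y \<in> vcar E then vnorm E (vadd E x (vscale E (- 1) y)) else 0)"

definition vtopology :: "('k::real_normed_field, 'e) nvs \<Rightarrow> 'e topology" where
  "vtopology E = Metric_space.mtopology (vcar E) (vdist E)"

definition banach_space :: "('k::real_normed_field, 'e) nvs \<Rightarrow> bool" where
  "banach_space E \<longleftrightarrow> normed_space E \<and> Metric_space.mcomplete (vcar E) (vdist E)"

definition separable_banach_space :: "('k::real_normed_field, 'e) nvs \<Rightarrow> bool" where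
  "separable_banach_space E \<longleftrightarrow> banach_space E \<and> separable_space (vtopology E)"

definition closed_subspace :: "('k::real_normed_field, 'e) nvs \<Rightarrow> 'e set \<Rightarrow> bool" where
  "closed_subspace E F \<longleftrightarrow> vzero E \<in> F \<and>
     (\<forall>x\<in>F. \<forall>y\<in>F. vadd E x y \<in> F) \<and> (\<forall>a. \<forall>x\<in>F. vscale E a x \<in> F) \<and>
     closedin (vtopology E) F"

abbreviation restr :: "('k, 'e) nvs \<Rightarrow> 'e set \<Rightarrow> ('k, 'e) nvs" where
  "restr E F \<equiv> E\<lparr>vcar := F\<rparr>"

text \<open>Operators are functions whose values outside the carrier of the domain are irrelevant.\<close>

definition bounded_operator ::
  "('k::real_normed_field, 'e) nvs \<Rightarrow> ('k, 'x) nvs \<Rightarrow> ('e \<Rightarrow> 'x) \<Rightarrow> bool" where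
  "bounded_operator E X T \<longleftrightarrow> T ` vcar E \<subseteq> vcar X \<and>
     (\<forall>x\<in>vcar E. \<forall>y\<in>vcar E. T (vadd E x y) = vadd X (T x) (T y)) \<and>
     (\<forall>a. \<forall>x\<in>vcar E. T (vscale E a x) = vscale X a (T x)) \<and>
     (\<exists>C. \<forall>x\<in>vcar E. vnorm X (T x) \<le> C * vnorm E x)"

definition op_norm ::
  "('k::real_normed_field, 'e) nvs \<Rightarrow> ('k, 'x) nvs \<Rightarrow> ('e \<Rightarrow> 'x) \<Rightarrow> real" where
  "op_norm E X T = Sup {vnorm X (T x) | x. x \<in> vcar E \<and> vnorm E x \<le> 1}"

section \<open>The space \<open>\<ell>\<^sub>\<infinity>\<close> and the subspace given by an ideal\<close>

definition linf :: "('k::real_normed_field, nat \<Rightarrow> 'k) nvs" where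
  "linf = \<lparr>vcar = {x. bounded (range x)},
           vadd = (\<lambda>x y n. x n + y n),
           vzero = (\<lambda>n. 0),
           vscale = (\<lambda>a x n. a * x n),
           vnorm = (\<lambda>x. SUP n. norm (x n))\<rparr>"

definition omega_ideal :: "nat set set \<Rightarrow> bool" where
  "omega_ideal I \<longleftrightarrow> {} \<in> I \<and> (\<forall>A\<in>I. \<forall>B. B \<subseteq> A \<longrightarrow> B \<in> I) \<and>
     (\<forall>A\<in>I. \<forall>B\<in>I. A \<union> B \<in> I) \<and> (\<forall>A. finite A \<longrightarrow> A \<in> I)"

definition proper_ideal :: "nat set set \<Rightarrow> bool" where
  "proper_ideal I \<longleftrightarrow> omega_ideal I \<and> I \<noteq> Pow UNIV"

definition c0_ideal :: "nat set set \<Rightarrow> (nat \<Rightarrow> 'k::real_normed_field) set" where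
  "c0_ideal I = {x. bounded (range x) \<and> (\<forall>\<epsilon>>0. {n. norm (x n) \<ge> \<epsilon>} \<in> I)}"

section \<open>The two constants\<close>

definition projection_onto :: "(nat \<Rightarrow> 'k::real_normed_field) set \<Rightarrow> ((nat \<Rightarrow> 'k) \<Rightarrow> nat \<Rightarrow> 'k) \<Rightarrow> bool"
  where "projection_onto Y P \<longleftrightarrow> bounded_operator linf (restr linf Y) P \<and>
     P ` vcar linf = Y \<and> (\<forall>x\<in>vcar linf. P (P x) = P x)"

definition comp_const :: "(nat \<Rightarrow> 'k::real_normed_field) set \<Rightarrow> ereal" where
  "comp_const Y = Inf {ereal (op_norm linf (restr linf Y) P) | P. projection_onto Y P}"

definition extends_into ::
  "('k::real_normed_field, 'x) nvs \<Rightarrow> real \<Rightarrow> ('k, 'e) nvs \<Rightarrow> bool" where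
  "extends_into X l E \<longleftrightarrow>
     (\<forall>F T. closed_subspace E F \<and> bounded_operator (restr E F) X T \<longrightarrow>
        (\<exists>T'. bounded_operator E X T' \<and> (\<forall>x\<in>F. T' x = T x) \<and>
              op_norm E X T' \<le> l * op_norm (restr E F) X T))"

text \<open>
  A separable Banach space has at most continuum many points, so quantifying over the structures
  carried by subsets of \<open>nat \<Rightarrow> 'k\<close> covers all separable Banach spaces over \<open>'k\<close>; the lemma
  \<open>extends_into_all_types\<close> below makes this precise.
\<close>

definition si_const :: "('k::real_normed_field, 'x) nvs \<Rightarrow> ereal" where
  "si_const X = Inf {ereal l | l. l > 0 \<and>
     (\<forall>E :: ('k, nat \<Rightarrow> 'k) nvs. separable_banach_space E \<longrightarrow> extends_into X l E)}"

subsection \<open>Independence of the carrier type\<close>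

context normed_space
begin

lemma scale_0: assumes "x \<in> vcar E" shows "vscale E 0 x = vzero E"
proof -
  let ?z = "vscale E 0 x"
  have z: "?z \<in> vcar E" by (simp add: assms scale_closed)
  have zz: "vadd E ?z ?z = ?z" using scale_add_left[OF assms, of 0 0] by simp
  obtain y where y: "y \<in> vcar E" "vadd E ?z y = vzero E" using add_inverse[OF z] by blast
  have "?z = vadd E ?z (vadd E ?z y)" using y z by (simp add: add_zero)
  also have "\<dots> = vzero E" using add_assoc[OF z z y(1)] zz y by simp
  finally show ?thesis .
qed

lemma add_scale_minus: "x \<in> vcar E \<Longrightarrow> vadd E x (vscale E (- 1) x) = vzero E"
  using scale_add_left[of x 1 "- 1"] by (simp add: scale_one scale_0)

lemma zero_add: "x \<in> vcar E \<Longrightarrow> vadd E (vzero E) x = x"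
  using add_commute[of x "vzero E"] add_zero zero_closed by simp

lemma norm_ge_0: assumes "x \<in> vcar E" shows "0 \<le> vnorm E x"
proof -
  have "vnorm E (vzero E) = 0" using norm_eq_0 zero_closed by blast
  then have "0 \<le> vnorm E x + vnorm E (vscale E (- 1) x)"
    using norm_triangle[of x "vscale E (- 1) x"] assms by (simp add: add_scale_minus scale_closed)
  then show ?thesis using assms by (simp add: norm_scale)
qed

lemma cancel_middle:
  assumes "x \<in> vcar E" "y \<in> vcar E" "z \<in> vcar E"
  shows "vadd E (vadd E x (vscale E (- 1) y)) (vadd E y z) = vadd E x z"
proof -
  have m: "vscale E (- 1) y \<in> vcar E" and yz: "vadd E y z \<in> vcar E"
    using assms by (auto simp: scale_closed add_closed)
  have "vadd E (vscale E (- 1) y) (vadd E y z) = vadd E (vadd E (vscale E (- 1) y) y) z"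
    using add_assoc[OF m assms(2,3)] by simp
  also have "\<dots> = z"
    using add_commute[OF m assms(2)] assms by (simp add: add_scale_minus zero_add)
  finally show ?thesis using add_assoc[OF assms(1) m yz] by simp
qed

lemma Metric_space_vdist: "Metric_space (vcar E) (vdist E)"
proof -
  have m: "vscale E (- 1) y \<in> vcar E" if "y \<in> vcar E" for y
    using that by (simp add: scale_closed)
  have sym: "vdist E x y = vdist E y x" if "x \<in> vcar E" "y \<in> vcar E" for x y
  proof -
    have "vscale E (- 1) (vadd E x (vscale E (- 1) y)) = vadd E (vscale E (- 1) x) y"
      using that m by (simp add: scale_add_right scale_scale scale_one)
    also have "\<dots> = vadd E y (vscale E (- 1) x)" using that m add_commute by blast
    finally have "vnorm E (vadd E y (vscale E (- 1) x))
        = vnorm E (vscale E (- 1) (vadd E x (vscale E (- 1) y)))" by simp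
    then show ?thesis using that m by (simp add: vdist_def norm_scale add_closed)
  qed
  have zero: "vdist E x y = 0 \<longleftrightarrow> x = y" if "x \<in> vcar E" "y \<in> vcar E" for x y
  proof
    assume "vdist E x y = 0"
    then have "vadd E x (vscale E (- 1) y) = vzero E"
      using that m by (simp add: vdist_def norm_eq_0 add_closed)
    then have "vadd E (vzero E) (vadd E y (vzero E)) = vadd E x (vzero E)"
      using cancel_middle[of x y "vzero E"] that zero_closed by simp
    then show "x = y" using that by (simp add: add_zero zero_add)
  next
    assume "x = y"
    then show "vdist E x y = 0"
      using that by (simp add: vdist_def add_scale_minus norm_eq_0 zero_closed)
  qed
  have tri: "vdist E x z \<le> vdist E x y + vdist E y z"
    if "x \<in> vcar E" "y \<in> vcar E" "z \<in> vcar E" for x y z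
    using that m norm_triangle[of "vadd E x (vscale E (- 1) y)" "vadd E y (vscale E (- 1) z)"]
      cancel_middle[of x y "vscale E (- 1) z"] by (simp add: vdist_def add_closed)
  have nn: "0 \<le> vdist E x y" if "x \<in> vcar E" "y \<in> vcar E" for x y
    using that m by (simp add: vdist_def norm_ge_0 add_closed)
  show ?thesis
  proof
    show "0 \<le> vdist E x y" for x y using nn by (cases "x \<in> vcar E \<and> y \<in> vcar E") (auto simp: vdist_def)
    show "vdist E x y = vdist E y x" for x y
      using sym by (cases "x \<in> vcar E \<and> y \<in> vcar E") (auto simp: vdist_def)
  qed (use zero tri in auto)
qed

end

lemma inj_on_continuum:
  assumes "separable_banach_space (E :: ('k::real_normed_field, 'e) nvs)"
  shows "\<exists>\<phi> :: 'e \<Rightarrow> nat \<Rightarrow> 'k. inj_on \<phi> (vcar E)"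
proof -
  interpret E: normed_space E
    using assms by (simp add: separable_banach_space_def banach_space_def)
  interpret M: Metric_space "vcar E" "vdist E" by (rule E.Metric_space_vdist)
  obtain C where C: "countable C" "C \<subseteq> vcar E" "M.mtopology closure_of C = vcar E"
    using assms by (auto simp: separable_banach_space_def separable_space_def vtopology_def)
  have "C \<noteq> {}" using C(3) E.zero_closed by auto
  then obtain c :: "nat \<Rightarrow> 'e" where c: "range c = C" using range_from_nat_into[OF _ C(1)] by blast
  define \<phi> :: "'e \<Rightarrow> nat \<Rightarrow> 'k" where "\<phi> x n = of_real (vdist E x (c n))" for x n
  have "x = y" if x: "x \<in> vcar E" and y: "y \<in> vcar E" and eq: "\<phi> x = \<phi> y" for x y
  proof (rule ccontr)
    assume "x \<noteq> y"
    then have r: "vdist E x y / 2 > 0" using x y by simp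
    have "x \<in> M.mtopology closure_of C" using C(3) x by simp
    then obtain q where q: "q \<in> C" "q \<in> M.mball x (vdist E x y / 2)"
      using r unfolding M.metric_closure_of by blast
    then obtain n where n: "q = c n" using c by blast
    have "vdist E x q = vdist E y q" using fun_cong[OF eq, of n] by (simp add: \<phi>_def n)
    moreover have "vdist E x y \<le> vdist E x q + vdist E q y" using q x y by (simp add: M.triangle)
    ultimately show False using q by (simp add: M.commute)
  qed
  then show ?thesis by (auto simp: inj_on_def)
qed

lemma extends_into_all_types:
  fixes X :: "('k::real_normed_field, 'x) nvs" and E :: "('k, 'e) nvs"
  assumes X: "\<And>G :: ('k, nat \<Rightarrow> 'k) nvs. separable_banach_space G \<Longrightarrow> extends_into X l G"
    and sep: "separable_banach_space E"
  shows "extends_into X l E"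
proof -
  interpret E: normed_space E
    using sep by (simp add: separable_banach_space_def banach_space_def)
  interpret M: Metric_space "vcar E" "vdist E" by (rule E.Metric_space_vdist)
  obtain \<phi> :: "'e \<Rightarrow> nat \<Rightarrow> 'k" where inj: "inj_on \<phi> (vcar E)"
    using inj_on_continuum[OF sep] by blast
  define \<psi> where "\<psi> = inv_into (vcar E) \<phi>"
  have \<psi>\<phi>: "\<psi> (\<phi> x) = x" if "x \<in> vcar E" for x using that inj by (simp add: \<psi>_def)
  define G :: "('k, nat \<Rightarrow> 'k) nvs" where
    "G = \<lparr>vcar = \<phi> ` vcar E, vadd = (\<lambda>u v. \<phi> (vadd E (\<psi> u) (\<psi> v))), vzero = \<phi> (vzero E),
          vscale = (\<lambda>a u. \<phi> (vscale E a (\<psi> u))), vnorm = (\<lambda>u. vnorm E (\<psi> u))\<rparr>"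
  have car: "vcar G = \<phi> ` vcar E" and zero: "vzero G = \<phi> (vzero E)" by (simp_all add: G_def)
  have add: "vadd G (\<phi> x) (\<phi> y) = \<phi> (vadd E x y)" if "x \<in> vcar E" "y \<in> vcar E" for x y
    using that by (simp add: G_def \<psi>\<phi>)
  have scale: "vscale G a (\<phi> x) = \<phi> (vscale E a x)" if "x \<in> vcar E" for a x
    using that by (simp add: G_def \<psi>\<phi>)
  have nrm: "vnorm G (\<phi> x) = vnorm E x" if "x \<in> vcar E" for x
    using that by (simp add: G_def \<psi>\<phi>)
  have eq: "\<phi> x = \<phi> y \<longleftrightarrow> x = y" if "x \<in> vcar E" "y \<in> vcar E" for x y
    using that inj by (simp add: inj_on_eq_iff)
  note tr = car zero add scale nrm eq E.zero_closed E.add_closed E.scale_closed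
  interpret G: normed_space G
  proof
    fix x y z assume "x \<in> vcar G" "y \<in> vcar G" "z \<in> vcar G"
    then show "vadd G (vadd G x y) z = vadd G x (vadd G y z)" by (auto simp: tr E.add_assoc)
  next
    fix x y assume "x \<in> vcar G" "y \<in> vcar G"
    then show "vadd G x y = vadd G y x" by (auto simp: tr E.add_commute)
  next
    fix x assume "x \<in> vcar G"
    then obtain x' where x': "x' \<in> vcar E" "x = \<phi> x'" by (auto simp: car)
    obtain y' where "y' \<in> vcar E" "vadd E x' y' = vzero E" using E.add_inverse[OF x'(1)] by blast
    then show "\<exists>y\<in>vcar G. vadd G x y = vzero G"
      using x' by (intro bexI[of _ "\<phi> y'"]) (auto simp: tr)
  qed (auto simp: tr E.add_zero E.scale_add_right E.scale_add_left E.scale_scale E.scale_one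
        E.norm_eq_0 E.norm_scale E.norm_triangle)
  interpret N: Metric_space "vcar G" "vdist G" by (rule G.Metric_space_vdist)
  interpret MN: Metric_space12 "vcar E" "vdist E" "vcar G" "vdist G" ..
  have dist: "vdist G (\<phi> x) (\<phi> y) = vdist E x y" if "x \<in> vcar E" "y \<in> vcar E" for x y
    using that by (simp add: vdist_def tr)
  have hom: "homeomorphic_map M.mtopology N.mtopology \<phi>"
    using MN.isometry_imp_homeomorphic_map[of \<phi>] dist car by simp
  have compl: "N.mcomplete"
    unfolding N.mcomplete_def
  proof (intro allI impI)
    fix \<sigma> assume \<sigma>: "N.MCauchy \<sigma>"
    have r: "\<sigma> n \<in> vcar G" for n using \<sigma> by (auto simp: N.MCauchy_def)
    have \<psi>\<sigma>: "\<psi> (\<sigma> n) \<in> vcar E" "\<phi> (\<psi> (\<sigma> n)) = \<sigma> n" for n using r[of n] by (auto simp: car \<psi>\<phi>)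
    have d: "vdist E (\<psi> (\<sigma> m)) (\<psi> (\<sigma> n)) = vdist G (\<sigma> m) (\<sigma> n)" for m n
      using dist[OF \<psi>\<sigma>(1) \<psi>\<sigma>(1), of m n] by (simp add: \<psi>\<sigma>(2))
    have "M.MCauchy (\<psi> \<circ> \<sigma>)" using \<sigma> \<psi>\<sigma>(1) by (auto simp: M.MCauchy_def N.MCauchy_def d)
    moreover have "M.mcomplete" using sep by (simp add: separable_banach_space_def banach_space_def)
    ultimately obtain x where x: "limitin M.mtopology (\<psi> \<circ> \<sigma>) x sequentially"
      by (auto simp: M.mcomplete_def)
    have "limitin N.mtopology (\<phi> \<circ> (\<psi> \<circ> \<sigma>)) (\<phi> x) sequentially"
      by (rule continuous_map_limit[OF homeomorphic_imp_continuous_map[OF hom] x])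
    moreover have "\<phi> \<circ> (\<psi> \<circ> \<sigma>) = \<sigma>" using \<psi>\<sigma>(2) by auto
    ultimately show "\<exists>u. limitin N.mtopology \<sigma> u sequentially" by metis
  qed
  have "separable_space N.mtopology"
    using sep separable_space_continuous_map_image[OF _ homeomorphic_imp_continuous_map[OF hom]
        homeomorphic_imp_surjective_map[OF hom]]
    by (simp add: separable_banach_space_def vtopology_def)
  with compl have "separable_banach_space G"
    by (simp add: separable_banach_space_def banach_space_def vtopology_def G.normed_space_axioms)
  then have ext: "extends_into X l G" by (rule X)
  show ?thesis
    unfolding extends_into_def
  proof (intro allI impI, elim conjE)
    fix F T assume F: "closed_subspace E F" and T: "bounded_operator (restr E F) X T"
    have FE: "F \<subseteq> vcar E"
      using F closedin_subset by (fastforce simp: closed_subspace_def vtopology_def)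
    have FE': "x \<in> vcar E" if "x \<in> F" for x using that FE by blast
    have "closedin N.mtopology (\<phi> ` F)"
      using F FE homeomorphic_map_closedness[OF hom, of F]
      by (simp add: closed_subspace_def vtopology_def)
    then have F': "closed_subspace G (\<phi> ` F)"
      using F FE' by (auto simp: closed_subspace_def vtopology_def tr)
    have T': "bounded_operator (restr G (\<phi> ` F)) X (T \<circ> \<psi>)"
      using T F FE' unfolding bounded_operator_def closed_subspace_def
      by (auto simp: tr \<psi>\<phi>)
    obtain S where S: "bounded_operator G X S" "\<forall>u\<in>\<phi> ` F. S u = (T \<circ> \<psi>) u"
        "op_norm G X S \<le> l * op_norm (restr G (\<phi> ` F)) X (T \<circ> \<psi>)"
      using ext F' T' unfolding extends_into_def by blast
    have "bounded_operator E X (S \<circ> \<phi>)"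
      using S(1) unfolding bounded_operator_def by (auto simp: tr)
    moreover have "\<forall>x\<in>F. (S \<circ> \<phi>) x = T x" using S(2) FE' by (auto simp: \<psi>\<phi>)
    moreover have "op_norm E X (S \<circ> \<phi>) = op_norm G X S"
    proof -
      have "{vnorm X ((S \<circ> \<phi>) x) | x. x \<in> vcar E \<and> vnorm E x \<le> 1}
          = {vnorm X (S u) | u. u \<in> vcar G \<and> vnorm G u \<le> 1}"
        by (fastforce simp: car nrm)
      then show ?thesis by (simp only: op_norm_def)
    qed
    moreover have "op_norm (restr G (\<phi> ` F)) X (T \<circ> \<psi>) = op_norm (restr E F) X T"
    proof -
      have eqs: "vnorm G (\<phi> x) = vnorm E x" "(T \<circ> \<psi>) (\<phi> x) = T x" if "x \<in> F" for x
        using FE'[OF that] by (simp_all add: nrm \<psi>\<phi>)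
      have "{vnorm X ((T \<circ> \<psi>) u) | u. u \<in> \<phi> ` F \<and> vnorm G u \<le> 1}
          = {vnorm X (T x) | x. x \<in> F \<and> vnorm E x \<le> 1}"
      proof (intro Set.set_eqI iffI; elim CollectE exE conjE)
        fix r u assume "r = vnorm X ((T \<circ> \<psi>) u)" "u \<in> \<phi> ` F" "vnorm G u \<le> 1"
        then show "r \<in> {vnorm X (T x) | x. x \<in> F \<and> vnorm E x \<le> 1}"
          using eqs by (auto simp del: o_apply)
      next
        fix r x assume "r = vnorm X (T x)" "x \<in> F" "vnorm E x \<le> 1"
        then show "r \<in> {vnorm X ((T \<circ> \<psi>) u) | u. u \<in> \<phi> ` F \<and> vnorm G u \<le> 1}"
          using eqs[of x] by (intro CollectI exI[of _ "\<phi> x"]) (auto simp del: o_apply)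
      qed
      then show ?thesis by (simp add: op_norm_def)
    qed
    ultimately show "\<exists>T'. bounded_operator E X T' \<and> (\<forall>x\<in>F. T' x = T x) \<and>
        op_norm E X T' \<le> l * op_norm (restr E F) X T" using S(3) by metis
  qed
qed

end

theory Submission
  imports Defs "HOL-Computational_Algebra.Fundamental_Theorem_Algebra"
begin

text \<open>
  Let \<open>T\<close> be an operator into \<open>c\<^sub>0\<^sub>,\<^sub>I\<close> that fixes all unit vectors \<open>e\<^sub>m\<close> and is defined at the constant
  sequence \<open>1\<close>. As the ideal is proper, some coordinate \<open>m\<close> of \<open>T 1\<close> is arbitrarily small. The sequence
  \<open>1 - 2 e\<^sub>m\<close> has norm \<open>1\<close> and its image has \<open>m\<close>-th coordinate close to \<open>- 2\<close>, so \<open>T\<close> has norm at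
  least \<open>2\<close>. This applies to projections and to extensions of the inclusion \<open>c \<inter> c\<^sub>0\<^sub>,\<^sub>I \<rightarrow> c\<^sub>0\<^sub>,\<^sub>I\<close> to the
  space \<open>c\<close> of convergent sequences.

  That \<open>c\<close> is a separable Banach space requires a complete and separable scalar field; for an abstract
  \<open>real_normed_field\<close> this comes from the Gelfand-Mazur theorem in Ostrowski's form: every element is a
  root of a real quadratic with non-positive discriminant, by minimizing the norm of its values.
\<close>

section \<open>The scalar field\<close>

abbreviation real_eval :: "real poly \<Rightarrow> 'a::real_normed_field \<Rightarrow> 'a" where
  "real_eval p x \<equiv> poly (map_poly of_real p) x"

lemma real_eval_mult: "real_eval (p * q) x = real_eval p x * real_eval q x"
proof -
  have "map_poly of_real (p * q) = (map_poly of_real p * map_poly of_real q :: 'a poly)"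
    by (intro poly_eqI) (simp add: coeff_map_poly coeff_mult)
  then show ?thesis by simp
qed

lemma real_eval_add: "real_eval (p + q) x = real_eval p x + real_eval q x"
proof -
  have "map_poly of_real (p + q) = (map_poly of_real p + map_poly of_real q :: 'a poly)"
    by (intro poly_eqI) (simp add: coeff_map_poly)
  then show ?thesis by simp
qed

lemma real_eval_minus: "real_eval (- p) x = - real_eval p x"
proof -
  have "map_poly of_real (- p) = (- map_poly of_real p :: 'a poly)"
    by (intro poly_eqI) (simp add: coeff_map_poly)
  then show ?thesis by simp
qed

lemma real_eval_of_real: "real_eval p (of_real t) = of_real (poly p t)"
  by (induction p) (simp_all add: map_poly_pCons)

lemma real_eval_power: "real_eval (p ^ n) x = real_eval p x ^ n"
  by (induction n) (simp_all add: real_eval_mult)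

section \<open>Minimizing the norm of a real quadratic in a scalar\<close>

text \<open>For \<open>b\<^sup>2 \<le> c\<close> this is the product of \<open>x - z\<close> and
  \<open>x - z'\<close> for conjugate complex numbers with real part \<open>b\<close> and squared
  modulus \<open>c\<close>. In these coordinates the admissible pairs form a closed set, and adding
  a real number to the value only shifts \<open>c\<close>.\<close>

definition real_quadratic :: "real \<Rightarrow> real \<Rightarrow> 'a::real_normed_field \<Rightarrow> 'a" where
  "real_quadratic b c x = x\<^sup>2 - 2 * of_real b * x + of_real c"

lemma real_eval_quadratic: "real_eval [:c, - 2 * b, 1:] x = real_quadratic b c x"
  by (simp add: map_poly_pCons real_quadratic_def power2_eq_square algebra_simps)

text \<open>A complex root supplies the factor: linear if the root is real, otherwise the product of
  the linear factors of the root and of its conjugate.\<close>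

lemma real_poly_monic_factor:
  fixes p :: "real poly"
  assumes "degree p > 0"
  shows "\<exists>q. q dvd p \<and> ((\<exists>r. q = [:- r, 1:]) \<or> (\<exists>b c. b\<^sup>2 \<le> c \<and> q = [:c, - 2 * b, 1:]))"
proof -
  have "degree (map_poly complex_of_real p) > 0"
    using assms by (subst degree_map_poly) auto
  then obtain z :: complex where z: "real_eval p z = 0"
    using fundamental_theorem_of_algebra constant_degree by (metis less_irrefl)
  show ?thesis
  proof (cases "Im z = 0")
    case True
    then have "z = of_real (Re z)" by (simp add: complex_eq_iff)
    then have "of_real (poly p (Re z)) = (0 :: complex)"
      using z by (metis real_eval_of_real)
    then have "[:- Re z, 1:] dvd p" by (simp add: poly_eq_0_iff_dvd)
    then show ?thesis by blast
  next
    case False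
    define q where "q = [:(Re z)\<^sup>2 + (Im z)\<^sup>2, - 2 * Re z, 1:]"
    have q: "q \<noteq> 0" "degree q = 2" by (auto simp: q_def)
    have "real_eval q z = 0"
      unfolding q_def real_eval_quadratic real_quadratic_def
      by (simp add: complex_eq_iff power2_eq_square algebra_simps)
    moreover have "p = q * (p div q) + p mod q" by simp
    ultimately have r: "real_eval (p mod q) z = 0"
      using z by (metis add_0 mult_zero_left real_eval_add real_eval_mult)
    \<comment> \<open>The remainder has degree at most 1 and vanishes at the non-real
      \<open>z\<close>, which forces both of its real coefficients to be zero.\<close>
    have "degree (p mod q) < 2 \<or> p mod q = 0" using degree_mod_less[of q p] q by auto
    then have "degree (p mod q) \<le> 1" by auto
    then have "p mod q = [:coeff (p mod q) 0, coeff (p mod q) 1:]"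
      by (intro poly_eqI) (auto simp: coeff_pCons coeff_eq_0 split: nat.split)
    then obtain u v where uv: "p mod q = [:u, v:]" by blast
    then have "of_real u + z * of_real v = 0" using r by (simp add: map_poly_pCons)
    then have "v = 0" "u = 0" using False by (auto simp: complex_eq_iff)
    then have "q dvd p" using uv by (simp add: mod_eq_0_iff_dvd)
    moreover have "(Re z)\<^sup>2 \<le> (Re z)\<^sup>2 + (Im z)\<^sup>2" by simp
    ultimately show ?thesis unfolding q_def by blast
  qed
qed

text \<open>The norm is multiplicative, so the factors from \<open>real_poly_monic_factor\<close>
  can be bounded one by one. A quadratic factor contributes \<open>s\<^sup>2\<close> by assumption;
  a linear one contributes \<open>s\<close> because its square is a quadratic with zero
  discriminant.\<close>

lemma norm_real_eval_ge:
  fixes a :: "'a::real_normed_field"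
  assumes s: "s \<ge> 0" and min: "\<And>b c. b\<^sup>2 \<le> c \<Longrightarrow> norm (real_quadratic b c a) \<ge> s\<^sup>2"
  shows "lead_coeff p = 1 \<Longrightarrow> norm (real_eval p a) \<ge> s ^ degree p"
proof (induction "degree p" arbitrary: p rule: less_induct)
  case less
  show ?case
  proof (cases "degree p = 0")
    case True
    then obtain c where "p = [:c:]" by (rule degree_eq_zeroE)
    then show ?thesis using less.prems by (simp add: map_poly_pCons)
  next
    case False
    then obtain q where qp: "q dvd p"
      and q: "(\<exists>r. q = [:- r, 1:]) \<or> (\<exists>b c. b\<^sup>2 \<le> c \<and> q = [:c, - 2 * b, 1:])"
      using real_poly_monic_factor by blast
    obtain h where h: "p = q * h" using qp by blast
    have nz: "q \<noteq> 0" "h \<noteq> 0" using less.prems h by auto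
    have dq: "degree q > 0" and lq: "lead_coeff q = 1" using q by auto
    have lh: "lead_coeff h = 1" using less.prems lq unfolding h lead_coeff_mult by simp
    have dp: "degree p = degree q + degree h" using h nz by (simp add: degree_mult_eq)
    have ih: "norm (real_eval h a) \<ge> s ^ degree h" using less.hyps[of h] dp dq lh by simp
    have "norm (real_eval q a) \<ge> s ^ degree q"
      using q
    proof (elim disjE exE conjE)
      fix r assume r: "q = [:- r, 1:]"
      have "real_quadratic r (r\<^sup>2) a = (a - of_real r)\<^sup>2"
        by (simp add: real_quadratic_def power2_eq_square algebra_simps)
      then have "s\<^sup>2 \<le> (norm (a - of_real r))\<^sup>2" using min[of r "r\<^sup>2"] by (simp add: norm_power)
      then have "s \<le> norm (a - of_real r)" by (rule power2_le_imp_le) simp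
      then show ?thesis by (simp add: r map_poly_pCons)
    next
      fix b c assume "b\<^sup>2 \<le> c" "q = [:c, - 2 * b, 1:]"
      then show ?thesis
        using min[of b c] real_eval_quadratic[of c b a] by (simp add: power2_eq_square)
    qed
    then have "s ^ degree q * s ^ degree h \<le> norm (real_eval q a) * norm (real_eval h a)"
      using ih s by (intro mult_mono) auto
    then show ?thesis by (simp add: h dp[unfolded h] real_eval_mult norm_mult power_add)
  qed
qed

text \<open>With \<open>q = real_quadratic b c a\<close>, the polynomial \<open>q + e\<close> divides \<open>q ^ n - (- e) ^ n\<close>, whose norm is
  at most \<open>m ^ n + e ^ n\<close>, while the cofactor has norm at least \<open>m ^ (n - 1)\<close>; let \<open>n\<close> tend to infinity.\<close>

lemma real_quadratic_shift_minimal: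
  fixes a :: "'a::real_normed_field"
  assumes m: "m > 0" and min: "\<And>b c. b\<^sup>2 \<le> c \<Longrightarrow> norm (real_quadratic b c a) \<ge> m"
    and bc: "b\<^sup>2 \<le> c" and eq: "norm (real_quadratic b c a) = m" and e: "0 < e" "e < m"
  shows "norm (real_quadratic b (c + e) a) = m"
proof -
  define q where "q = real_quadratic b c a"
  define Q where "Q = [:c, - 2 * b, 1:]"
  have Qq: "real_eval Q a = q" by (simp only: q_def Q_def real_eval_quadratic)
  have qe: "real_quadratic b (c + e) a = q + of_real e" by (simp add: q_def real_quadratic_def)
  have sq: "(sqrt m)\<^sup>2 = m" using m by simp
  have bound: "norm (q + of_real e) \<le> m * (1 + (e / m) ^ Suc n)" for n
  proof -
    \<comment> \<open>The geometric sum, which is the cofactor of \<open>Q + [:e:]\<close> in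
      \<open>Q ^ Suc n - [:- e:] ^ Suc n\<close>.\<close>
    define H where "H = (\<Sum>i<Suc n. [:- e:] ^ (Suc n - Suc i) * Q ^ i)"
    have QH: "(Q + [:e:]) * H = Q ^ Suc n - [:- e:] ^ Suc n"
      using power_diff_sumr2[of Q "Suc n" "[:- e:]"] by (simp add: H_def)
    have degQ: "degree (Q ^ k) = 2 * k" for k by (simp add: degree_power_eq Q_def)
    have leadQ: "lead_coeff (Q ^ k) = 1" for k unfolding lead_coeff_power by (simp add: Q_def)
    have "[:- e:] ^ Suc n = [:(- e) ^ Suc n:]" by (rule poly_const_pow)
    \<comment> \<open>Subtracting a constant leaves the power of \<open>Q\<close> monic of degree
      \<open>2 * Suc n\<close>; dividing out the monic quadratic \<open>Q + [:e:]\<close> leaves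
      \<open>H\<close> monic of degree \<open>2 * n\<close>.\<close>
    then have const: "degree (- ([:- e:] ^ Suc n)) < degree (Q ^ Suc n)"
      unfolding degQ by simp
    have d1: "degree (Q ^ Suc n - [:- e:] ^ Suc n) = 2 * Suc n"
      and l1: "lead_coeff (Q ^ Suc n - [:- e:] ^ Suc n) = 1"
      using degree_add_eq_left[OF const] lead_coeff_add_le[OF const] degQ[of "Suc n"] leadQ[of "Suc n"]
      by (simp_all add: add.commute)
    have Qe: "Q + [:e:] \<noteq> 0" "degree (Q + [:e:]) = 2" "lead_coeff (Q + [:e:]) = 1"
      by (simp_all add: Q_def)
    have lH: "lead_coeff H = 1" using l1 Qe(3) unfolding QH[symmetric] lead_coeff_mult by simp
    then have "H \<noteq> 0" by auto
    then have dH: "degree H = 2 * n" using d1 Qe unfolding QH[symmetric] by (simp add: degree_mult_eq)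
    \<comment> \<open>\<open>norm_real_eval_ge\<close> counts one factor \<open>s\<close> per
      degree, so \<open>s = sqrt m\<close> and degree \<open>2 * n\<close> give
      \<open>m ^ n\<close>.\<close>
    have "sqrt m ^ degree H \<le> norm (real_eval H a)"
      using lH m min sq by (intro norm_real_eval_ge) auto
    then have "m ^ n \<le> norm (real_eval H a)" by (simp add: dH power_mult sq)
    then have "norm (q + of_real e) * m ^ n \<le> norm ((q + of_real e) * real_eval H a)"
      by (simp add: norm_mult mult_left_mono)
    also have "(q + of_real e) * real_eval H a = real_eval ((Q + [:e:]) * H) a"
      by (simp only: real_eval_mult real_eval_add Qq) (simp add: map_poly_pCons)
    also have "\<dots> = q ^ Suc n - of_real (- e) ^ Suc n"
      unfolding QH diff_conv_add_uminus real_eval_add real_eval_minus real_eval_power Qq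
      by (simp add: map_poly_pCons)
    also have "norm \<dots> \<le> m ^ Suc n + e ^ Suc n"
      by (rule order_trans[OF norm_triangle_ineq4])
        (use e in \<open>simp add: eq[folded q_def] norm_power norm_mult\<close>)
    also have "\<dots> = m * (1 + (e / m) ^ Suc n) * m ^ n" using m by (simp add: field_simps)
    finally show ?thesis using m by (simp add: mult_le_cancel_right)
  qed
  have "(\<lambda>n. (e / m) ^ Suc n) \<longlonglongrightarrow> 0"
    using e m by (intro LIMSEQ_Suc LIMSEQ_realpow_zero) auto
  then have "(\<lambda>n. m * (1 + (e / m) ^ Suc n)) \<longlonglongrightarrow> m * (1 + 0)" by (intro tendsto_intros)
  then have "norm (q + of_real e) \<le> m * (1 + 0)"
    by (rule LIMSEQ_le_const) (use bound in blast)
  moreover have "m \<le> norm (q + of_real e)" using min[of b "c + e"] bc e by (simp add: qe)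
  ultimately show ?thesis by (simp add: qe)
qed

text \<open>Coercivity in \<open>c\<close>, which reduces the minimization to a compact set. Solve
  for \<open>c\<close>, use \<open>\<bar>b\<bar> \<le> sqrt c\<close>, and complete the square in
  \<open>sqrt c\<close>.\<close>

lemma norm_real_quadratic_ge:
  fixes a :: "'a::real_normed_field"
  assumes "b\<^sup>2 \<le> c"
  shows "norm (real_quadratic b c a) \<ge> (sqrt c - norm a)\<^sup>2 - 2 * (norm a)\<^sup>2"
proof -
  have c: "c \<ge> 0" and b: "\<bar>b\<bar> \<le> sqrt c"
    using assms zero_le_power2[of b] by (linarith, simp add: real_le_rsqrt)
  have "of_real c = real_quadratic b c a - (a\<^sup>2 - 2 * of_real b * a)"
    by (simp add: real_quadratic_def)
  then have "c \<le> norm (real_quadratic b c a) + norm (a\<^sup>2 - 2 * of_real b * a)"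
    using c by (metis norm_triangle_ineq4 norm_of_real abs_of_nonneg)
  moreover have "norm (a\<^sup>2 - 2 * of_real b * a) \<le> (norm a)\<^sup>2 + 2 * \<bar>b\<bar> * norm a"
    by (rule order_trans[OF norm_triangle_ineq4]) (simp add: norm_mult norm_power)
  moreover have "2 * \<bar>b\<bar> * norm a \<le> 2 * sqrt c * norm a"
    using b by (intro mult_right_mono) auto
  ultimately show ?thesis using c by (simp add: power2_diff)
qed

text \<open>By coercivity the norm attains a minimum \<open>m\<close> over the admissible pairs. If
  \<open>m > 0\<close>, then \<open>real_quadratic_shift_minimal\<close> can be iterated: the norm
  stays \<open>m\<close> while the value is moved by arbitrarily large real numbers, which is
  absurd.\<close>

lemma real_quadratic_root_exists:
  fixes a :: "'a::real_normed_field"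
  obtains b c where "b\<^sup>2 \<le> c" "real_quadratic b c a = 0"
proof -
  define f where "f = (\<lambda>z. norm (real_quadratic (fst z) (snd z) a))"
  \<comment> \<open>For \<open>c > R\<close> one has
    \<open>sqrt c - norm a \<ge> 3 * norm a\<close>, so coercivity gives a value of at least
    \<open>7 * (norm a)\<^sup>2\<close>, which is no smaller than the value
    \<open>(norm a)\<^sup>2\<close> at the pair \<open>(0, 0)\<close>.\<close>
  define R where "R = (4 * norm a + 1)\<^sup>2"
  define S where "S = {z. (fst z)\<^sup>2 \<le> snd z} \<inter> cbox (- sqrt R, 0) (sqrt R, R)"
  have R: "R \<ge> 0" by (simp add: R_def)
  have "closed {z::real \<times> real. (fst z)\<^sup>2 \<le> snd z}"
    by (intro closed_Collect_le continuous_intros)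
  then have "compact S" unfolding S_def by (intro closed_Int_compact compact_cbox)
  moreover have 0: "(0, 0) \<in> S" using R by (simp add: S_def)
  moreover have "continuous_on S f"
    unfolding f_def real_quadratic_def by (intro continuous_intros)
  ultimately obtain z where z: "z \<in> S" and zmin: "\<And>w. w \<in> S \<Longrightarrow> f z \<le> f w"
    using continuous_attains_inf[of S f] by blast
  obtain b c where zbc: "z = (b, c)" by fastforce
  define m where "m = f z"
  have large: "f (b', c') \<ge> f z" if bc': "b'\<^sup>2 \<le> c'" for b' c'
  proof (cases "c' \<le> R")
    case True
    have "c' \<ge> 0" using bc' zero_le_power2[of b'] by linarith
    moreover have "\<bar>b'\<bar> \<le> sqrt R" using bc' True by (intro real_le_rsqrt) auto
    ultimately have "(b', c') \<in> S" using bc' True by (auto simp: S_def)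
    then show ?thesis by (rule zmin)
  next
    case False
    then have "sqrt c' \<ge> 4 * norm a + 1" by (intro real_le_rsqrt) (simp add: R_def)
    then have "(sqrt c' - norm a)\<^sup>2 \<ge> (3 * norm a)\<^sup>2" by (intro power_mono) auto
    then have "f (b', c') \<ge> (norm a)\<^sup>2"
      using norm_real_quadratic_ge[OF bc', of a] by (simp add: f_def power_mult_distrib) (smt (verit) zero_le_power2)
    moreover have "f (0, 0) = (norm a)\<^sup>2" by (simp add: f_def real_quadratic_def norm_power)
    ultimately show ?thesis using zmin[OF 0] by simp
  qed
  have bc: "b\<^sup>2 \<le> c" using z zbc by (simp add: S_def)
  have "m = 0"
  proof (rule ccontr)
    assume "m \<noteq> 0"
    then have m: "m > 0" by (simp add: m_def f_def)
    have fm: "m \<le> norm (real_quadratic b' c' a)" if "b'\<^sup>2 \<le> c'" for b' c'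
      using large[OF that] by (simp add: m_def f_def)
    \<comment> \<open>A shift by \<open>m / 2\<close> lies strictly between 0 and \<open>m\<close>,
      and increasing \<open>c\<close> keeps the pair admissible, so the shift can be
      repeated.\<close>
    have step: "norm (real_quadratic b (c + real k * (m / 2)) a) = m" for k
    proof (induction k)
      case 0
      then show ?case by (simp add: m_def f_def zbc)
    next
      case (Suc k)
      have "b\<^sup>2 \<le> c + real k * (m / 2)" using bc m by (simp add: add_increasing2)
      from real_quadratic_shift_minimal[OF m fm this Suc, of "m / 2"] m
      show ?case by (simp add: algebra_simps add_divide_distrib)
    qed
    define q where "q = real_quadratic b c a"
    have "real k * (m / 2) \<le> 2 * m" for k
    proof -
      have "of_real (real k * (m / 2)) = real_quadratic b (c + real k * (m / 2)) a - q"
        by (simp add: real_quadratic_def q_def)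
      then have "\<bar>real k * (m / 2)\<bar> \<le> m + m"
        using norm_triangle_ineq4[of "real_quadratic b (c + real k * (m / 2)) a" q] step[of k] step[of 0]
        by (metis add.right_neutral mult_zero_left norm_of_real of_nat_0 q_def)
      then show ?thesis by simp
    qed
    \<comment> \<open>Any \<open>k\<close> above 4 contradicts the bound.\<close>
    from this[of 5] m show False by simp
  qed
  then show thesis using that bc by (simp add: m_def f_def zbc)
qed

text \<open>The Gelfand-Mazur theorem in coordinates; the scalar field is \<open>\<real>\<close> when \<open>j = 0\<close>.\<close>

lemma real_normed_field_coordinates:
  obtains j :: "'a::real_normed_field"
  where "\<And>a. \<exists>b d. a = of_real b + of_real d * j \<and> \<bar>b\<bar> \<le> 2 * norm a \<and> \<bar>d\<bar> \<le> 2 * norm a"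
proof (cases "range (of_real :: real \<Rightarrow> 'a) = UNIV")
  case True
  have "\<exists>b d. a = of_real b + of_real d * 0 \<and> \<bar>b\<bar> \<le> 2 * norm a \<and> \<bar>d\<bar> \<le> 2 * norm a" for a :: 'a
  proof -
    obtain b where "a = of_real b" using True by blast
    then show ?thesis by (intro exI[of _ b] exI[of _ 0]) simp
  qed
  then show ?thesis by (rule that)
next
  case False
  have root: "\<exists>b d. (a - of_real b)\<^sup>2 = - (of_real d)\<^sup>2" for a :: 'a
  proof -
    obtain b c where bc: "b\<^sup>2 \<le> c" "real_quadratic b c a = 0" by (rule real_quadratic_root_exists)
    \<comment> \<open>Complete the square; \<open>c - b\<^sup>2\<close> is non-negative and so has a
      real square root.\<close>
    then have "(a - of_real b)\<^sup>2 = - (of_real (sqrt (c - b\<^sup>2)))\<^sup>2"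
      by (simp add: real_quadratic_def power2_diff flip: of_real_power) (simp add: algebra_simps)
    then show ?thesis by blast
  qed
  \<comment> \<open>A scalar outside the reals yields, after translation and scaling, a square root
    \<open>j\<close> of \<open>- 1\<close>.\<close>
  from False obtain a :: 'a where a: "a \<notin> range of_real" by blast
  obtain b d where bd: "(a - of_real b)\<^sup>2 = - (of_real d)\<^sup>2" using root by blast
  have d: "d \<noteq> 0" using bd a by auto
  define j where "j = (a - of_real b) / of_real d"
  have j: "j\<^sup>2 = - 1" using d by (simp add: j_def power_divide bd)
  then have nj: "norm j = 1"
    by (metis norm_minus_cancel norm_one norm_power norm_ge_zero power2_eq_1_iff
        not_one_le_zero neg_0_le_iff_le)
  have "\<exists>b d. x = of_real b + of_real d * j \<and> \<bar>b\<bar> \<le> 2 * norm x \<and> \<bar>d\<bar> \<le> 2 * norm x" for x :: 'a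
  proof -
    obtain b d where bd: "(x - of_real b)\<^sup>2 = - (of_real d)\<^sup>2" using root by blast
    then have "(x - of_real b)\<^sup>2 = (of_real d * j)\<^sup>2" by (simp add: power_mult_distrib j)
    then have "x - of_real b = of_real d * j \<or> x - of_real b = of_real (- d) * j"
      by (simp add: power2_eq_iff)
    then obtain d where "x - of_real b = of_real d * j" by blast
    then have x: "x = of_real b + of_real d * j" by (simp add: algebra_simps)
    \<comment> \<open>Multiplying \<open>x\<close> by its conjugate gives a real number. This bounds
      the coordinates by \<open>2 * norm x\<close> without knowing that the norm is the Euclidean
      modulus.\<close>
    have "x * (of_real b - of_real d * j) = (of_real b)\<^sup>2 - (of_real d)\<^sup>2 * j\<^sup>2"
      by (simp add: x algebra_simps power2_eq_square)
    then have "x * (of_real b - of_real d * j) = of_real (b\<^sup>2 + d\<^sup>2)" by (simp add: j)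
    then have "norm x * norm (of_real b - of_real d * j) = b\<^sup>2 + d\<^sup>2"
      by (metis norm_mult norm_of_real abs_of_nonneg sum_power2_ge_zero)
    moreover have "norm (of_real b - of_real d * j) \<le> \<bar>b\<bar> + \<bar>d\<bar>"
      by (rule order_trans[OF norm_triangle_ineq4]) (simp add: norm_mult nj)
    ultimately have le: "b\<^sup>2 + d\<^sup>2 \<le> norm x * (\<bar>b\<bar> + \<bar>d\<bar>)"
      by (metis mult_left_mono norm_ge_zero)
    define M where "M = max \<bar>b\<bar> \<bar>d\<bar>"
    have "M \<ge> 0" by (simp add: M_def)
    have "M\<^sup>2 \<le> b\<^sup>2 + d\<^sup>2" by (auto simp: M_def max_def)
    also have "\<dots> \<le> norm x * (2 * M)"
      by (rule order_trans[OF le]) (auto simp: M_def intro!: mult_left_mono)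
    finally have "M * M \<le> 2 * norm x * M" by (simp add: power2_eq_square)
    then have "M \<le> 2 * norm x"
      using \<open>M \<ge> 0\<close> by (cases "M = 0") (simp_all add: mult_le_cancel_right)
    then show ?thesis using x by (auto simp: M_def)
  qed
  then show ?thesis by (rule that)
qed

section \<open>Completeness and separability of the scalar field\<close>

text \<open>A Cauchy sequence is bounded, so the coordinate bounds place it in the continuous image
  of a closed rectangle, which is compact and hence complete.\<close>

lemma complete_real_normed_field: "complete (UNIV :: 'a::real_normed_field set)"
  unfolding complete_def
proof (intro allI impI, elim conjE)
  fix f :: "nat \<Rightarrow> 'a" assume C: "Cauchy f"
  obtain j :: 'a where
    j: "\<And>a::'a. \<exists>b d. a = of_real b + of_real d * j \<and> \<bar>b\<bar> \<le> 2 * norm a \<and> \<bar>d\<bar> \<le> 2 * norm a"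
    using real_normed_field_coordinates by blast
  obtain B where B: "\<And>n. norm (f n) \<le> B"
    using cauchy_imp_bounded[OF C] by (auto simp: bounded_iff)
  define K where "K = (\<lambda>z. of_real (fst z) + of_real (snd z) * j) ` cbox (- (2 * B), - (2 * B)) (2 * B, 2 * B)"
  have "compact K"
    unfolding K_def by (intro compact_continuous_image compact_cbox continuous_intros)
  moreover have "f n \<in> K" for n
  proof -
    obtain b d where bd: "f n = of_real b + of_real d * j" "\<bar>b\<bar> \<le> 2 * norm (f n)" "\<bar>d\<bar> \<le> 2 * norm (f n)"
      using j by blast
    then have "(b, d) \<in> cbox (- (2 * B), - (2 * B)) (2 * B, 2 * B)" using B[of n] by auto
    then show ?thesis using bd(1) unfolding K_def by force
  qed
  ultimately show "\<exists>l\<in>UNIV. f \<longlonglongrightarrow> l"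
    using compact_imp_complete[of K] C unfolding complete_def by blast
qed

lemma separable_real_normed_field:
  obtains D :: "'a::real_normed_field set" where "countable D" "\<And>x e. e > 0 \<Longrightarrow> \<exists>y\<in>D. norm (x - y) < e"
proof -
  obtain j :: 'a where
    j: "\<And>a::'a. \<exists>b d. a = of_real b + of_real d * j \<and> \<bar>b\<bar> \<le> 2 * norm a \<and> \<bar>d\<bar> \<le> 2 * norm a"
    using real_normed_field_coordinates by blast
  define D where "D = (\<lambda>(b, d). of_real b + of_real d * j) ` (\<rat> \<times> \<rat>)"
  have "countable D" unfolding D_def by (intro countable_image countable_SIGMA countable_rat)
  moreover have "\<exists>y\<in>D. norm (x - y) < e" if e: "e > 0" for x :: 'a and e
  proof -
    obtain b d where x: "x = of_real b + of_real d * j" using j by blast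
    \<comment> \<open>Both coordinate errors will be at most \<open>t\<close>, for a total of at
      most \<open>t * (1 + norm j) = e / 2\<close>.\<close>
    define t where "t = e / (2 * (1 + norm j))"
    have nj: "1 + norm j > 0" by (simp add: add_pos_nonneg)
    then have t: "t > 0" using e by (simp add: t_def)
    obtain b' where b': "b' \<in> \<rat>" "b < b'" "b' < b + t" using Rats_dense_in_real[of b "b + t"] t by auto
    obtain d' where d': "d' \<in> \<rat>" "d < d'" "d' < d + t" using Rats_dense_in_real[of d "d + t"] t by auto
    have "x - (of_real b' + of_real d' * j) = of_real (b - b') + of_real (d - d') * j"
      by (simp add: x algebra_simps)
    then have "norm (x - (of_real b' + of_real d' * j)) \<le> \<bar>b - b'\<bar> + \<bar>d - d'\<bar> * norm j"
      by (metis norm_triangle_ineq norm_mult norm_of_real)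
    also have "\<dots> \<le> t + t * norm j" using b' d' by (intro add_mono mult_right_mono) auto
    also have "\<dots> = t * (1 + norm j)" by (simp add: distrib_left)
    also have "\<dots> = e / 2" using nj unfolding t_def by (metis less_irrefl mult.commute
        nonzero_mult_divide_mult_cancel_left2 times_divide_eq_left)
    also have "\<dots> < e" using e by simp
    finally show ?thesis using b' d' unfolding D_def by force
  qed
  ultimately show ?thesis by (rule that)
qed

section \<open>Subspaces of \<open>\<ell>\<^sub>\<infinity>\<close>\<close>

lemma linf_simps [simp]:
  "vcar linf = {x. bounded (range x)}"
  "vadd linf x y = (\<lambda>n. x n + y n)"
  "vzero linf = (\<lambda>n. 0)"
  "vscale linf a x = (\<lambda>n. a * x n)"
  by (simp_all add: linf_def)

lemma norm_le_vnorm_linf: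
  assumes "bounded (range x)"
  shows "norm (x n) \<le> vnorm linf x"
proof -
  have "bdd_above (range (\<lambda>n. norm (x n)))"
    using assms by (auto simp: bounded_iff bdd_above_def)
  then show ?thesis unfolding linf_def by (simp add: cSUP_upper[of n UNIV "\<lambda>n. norm (x n)"])
qed

lemma vnorm_linf_le: "(\<And>n. norm (x n) \<le> B) \<Longrightarrow> vnorm linf x \<le> B"
  by (simp add: linf_def cSUP_least)

lemma bounded_range_add:
  "bounded (range x) \<Longrightarrow> bounded (range y) \<Longrightarrow>
    bounded (range (\<lambda>n::nat. x n + y n :: 'k::real_normed_field))"
  by (rule bounded_plus_comp)

lemma bounded_range_mult:
  assumes "bounded (range x)"
  shows "bounded (range (\<lambda>n::nat. a * x n :: 'k::real_normed_field))"
proof -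
  obtain B where "\<And>n. norm (x n) \<le> B" using assms by (auto simp: bounded_iff)
  then have "norm (a * x n) \<le> norm a * B" for n by (simp add: norm_mult mult_left_mono)
  then show ?thesis by (auto simp: bounded_iff)
qed

text \<open>A purely algebraic notion that suffices for the norm axioms; completeness and closedness
  are proved separately.\<close>

definition linf_subspace :: "(nat \<Rightarrow> 'k::real_normed_field) set \<Rightarrow> bool" where
  "linf_subspace V \<longleftrightarrow> V \<subseteq> {x. bounded (range x)} \<and> (\<lambda>n. 0) \<in> V \<and>
     (\<forall>x\<in>V. \<forall>y\<in>V. (\<lambda>n. x n + y n) \<in> V) \<and> (\<forall>a. \<forall>x\<in>V. (\<lambda>n. a * x n) \<in> V)"

lemma linf_subspace_bounded: "linf_subspace V \<Longrightarrow> x \<in> V \<Longrightarrow> bounded (range x)"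
  by (auto simp: linf_subspace_def)

lemma linf_subspace_add: "linf_subspace V \<Longrightarrow> x \<in> V \<Longrightarrow> y \<in> V \<Longrightarrow> (\<lambda>n. x n + y n) \<in> V"
  by (simp add: linf_subspace_def)

lemma linf_subspace_mult: "linf_subspace V \<Longrightarrow> x \<in> V \<Longrightarrow> (\<lambda>n. a * x n) \<in> V"
  by (simp add: linf_subspace_def)

lemma linf_subspace_Int: "linf_subspace V \<Longrightarrow> linf_subspace W \<Longrightarrow> linf_subspace (V \<inter> W)"
  by (auto simp: linf_subspace_def)

lemma linf_subspace_bounded_seqs: "linf_subspace {x. bounded (range x)}"
  by (auto simp: linf_subspace_def bounded_range_add bounded_range_mult)

lemma vnorm_linf_eq_0:
  assumes "bounded (range x)"
  shows "vnorm linf x = 0 \<longleftrightarrow> x = (\<lambda>n. 0)"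
proof
  assume "vnorm linf x = 0"
  then show "x = (\<lambda>n. 0)" using norm_le_vnorm_linf[OF assms] by auto
qed (simp add: linf_def)

lemma vnorm_linf_mult:
  fixes x :: "nat \<Rightarrow> 'k::real_normed_field"
  assumes "bounded (range x)"
  shows "vnorm linf (\<lambda>n. a * x n) = norm a * vnorm linf x"
proof (rule antisym)
  have le: "vnorm linf (\<lambda>n. b * y n) \<le> norm b * vnorm linf y"
    if "bounded (range y)" for b and y :: "nat \<Rightarrow> 'k"
    using norm_le_vnorm_linf[OF that] by (intro vnorm_linf_le) (simp add: norm_mult mult_left_mono)
  show "vnorm linf (\<lambda>n. a * x n) \<le> norm a * vnorm linf x" using assms by (rule le)
  show "norm a * vnorm linf x \<le> vnorm linf (\<lambda>n. a * x n)"
  proof (cases "a = 0")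
    case True
    then show ?thesis by (simp add: linf_def)
  next
    case False
    \<comment> \<open>The reverse estimate is the first one for \<open>inverse a\<close>, applied to
      the scaled sequence.\<close>
    then have "vnorm linf x \<le> norm (inverse a) * vnorm linf (\<lambda>n. a * x n)"
      using le[OF bounded_range_mult[OF assms, of a], of "inverse a"] by (simp flip: mult.assoc)
    then show ?thesis using False by (simp add: norm_inverse norm_divide field_simps)
  qed
qed

lemma normed_space_linf_subspace:
  assumes V: "linf_subspace (V :: (nat \<Rightarrow> 'k::real_normed_field) set)"
  shows "normed_space (restr linf V)"
proof
  fix x y assume "x \<in> vcar (restr linf V)" "y \<in> vcar (restr linf V)"
  then have "bounded (range x)" "bounded (range y)" using V by (auto intro: linf_subspace_bounded)
  then have "norm (x n + y n) \<le> vnorm linf x + vnorm linf y" for n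
    using norm_le_vnorm_linf[of x n] norm_le_vnorm_linf[of y n] norm_triangle_ineq[of "x n" "y n"]
    by linarith
  then show "vnorm (restr linf V) (vadd (restr linf V) x y)
      \<le> vnorm (restr linf V) x + vnorm (restr linf V) y"
    by (simp add: vnorm_linf_le)
next
  fix x assume "x \<in> vcar (restr linf V)"
  then have "(\<lambda>n. - 1 * x n) \<in> V" using V by (intro linf_subspace_mult) simp_all
  then show "\<exists>y\<in>vcar (restr linf V). vadd (restr linf V) x y = vzero (restr linf V)"
    by (intro bexI[of _ "\<lambda>n. - 1 * x n"]) simp_all
qed (use V in \<open>auto simp: linf_subspace_def algebra_simps subset_eq vnorm_linf_eq_0 vnorm_linf_mult\<close>)

lemma vdist_linf_subspace:
  assumes "x \<in> V" "y \<in> V"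
  shows "vdist (restr linf V) x y = vnorm linf (\<lambda>n. x n - y n)"
  using assms by (simp add: vdist_def)

lemma norm_le_vdist_linf:
  assumes V: "linf_subspace V" and "x \<in> V" "y \<in> V"
  shows "norm (x n - y n) \<le> vdist (restr linf V) x y"
proof -
  have "bounded (range (\<lambda>n. x n + - 1 * y n))"
    using assms by (intro bounded_range_add bounded_range_mult linf_subspace_bounded)
  then show ?thesis
    using norm_le_vnorm_linf[of "\<lambda>n. x n - y n" n] assms by (simp add: vdist_linf_subspace)
qed

section \<open>Operators fixing the unit vectors\<close>

abbreviation unit_seq :: "nat \<Rightarrow> nat \<Rightarrow> 'k::real_normed_field" where
  "unit_seq m \<equiv> (\<lambda>n. if n = m then 1 else 0)"

lemma c0_idealD: "x \<in> c0_ideal I \<Longrightarrow> e > 0 \<Longrightarrow> {n. e \<le> norm (x n)} \<in> I"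
  by (simp add: c0_ideal_def)

lemma linf_subspace_c0_ideal:
  assumes "omega_ideal I"
  shows "linf_subspace (c0_ideal I :: (nat \<Rightarrow> 'k::real_normed_field) set)"
proof -
  have sub: "B \<in> I" if "A \<in> I" "B \<subseteq> A" for A B using assms that by (auto simp: omega_ideal_def)
  have un: "A \<union> B \<in> I" if "A \<in> I" "B \<in> I" for A B using assms that by (auto simp: omega_ideal_def)
  have "(\<lambda>n. x n + y n) \<in> c0_ideal I" if xy: "x \<in> c0_ideal I" "y \<in> c0_ideal I" for x y :: "nat \<Rightarrow> 'k"
  proof -
    have "{n. e \<le> norm (x n + y n)} \<in> I" if e: "e > 0" for e
    proof (rule sub)
      show "{n. e / 2 \<le> norm (x n)} \<union> {n. e / 2 \<le> norm (y n)} \<in> I"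
        using xy e by (intro un c0_idealD) auto
      show "{n. e \<le> norm (x n + y n)} \<subseteq> {n. e / 2 \<le> norm (x n)} \<union> {n. e / 2 \<le> norm (y n)}"
      proof
        fix n assume "n \<in> {n. e \<le> norm (x n + y n)}"
        then show "n \<in> {n. e / 2 \<le> norm (x n)} \<union> {n. e / 2 \<le> norm (y n)}"
          using norm_triangle_ineq[of "x n" "y n"] by simp linarith
      qed
    qed
    then show ?thesis using xy by (auto simp: c0_ideal_def bounded_range_add)
  qed
  moreover have "(\<lambda>n. a * x n) \<in> c0_ideal I" if x: "x \<in> c0_ideal I" for a and x :: "nat \<Rightarrow> 'k"
  proof -
    have "{n. e \<le> norm (a * x n)} \<in> I" if e: "e > 0" for e
    proof (rule sub)
      \<comment> \<open>The \<open>+ 1\<close> keeps the denominator positive when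
        \<open>a = 0\<close>.\<close>
      show "{n. e / (norm a + 1) \<le> norm (x n)} \<in> I"
        using x e by (intro c0_idealD) (auto simp: add_nonneg_pos)
      show "{n. e \<le> norm (a * x n)} \<subseteq> {n. e / (norm a + 1) \<le> norm (x n)}"
      proof clarify
        fix n assume "e \<le> norm (a * x n)"
        also have "\<dots> \<le> (norm a + 1) * norm (x n)" by (simp add: norm_mult mult_right_mono)
        finally show "e / (norm a + 1) \<le> norm (x n)"
          by (simp add: pos_divide_le_eq add_nonneg_pos mult.commute)
      qed
    qed
    then show ?thesis using x by (auto simp: c0_ideal_def bounded_range_mult)
  qed
  moreover have "(\<lambda>n. 0) \<in> c0_ideal I" using assms by (auto simp: c0_ideal_def omega_ideal_def)
  ultimately show ?thesis by (auto simp: linf_subspace_def c0_ideal_def)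
qed

lemma unit_seq_in_c0_ideal: 
  assumes I: "omega_ideal I"
  shows "(unit_seq m :: nat \<Rightarrow> 'k::real_normed_field) \<in> c0_ideal I"
proof -
  have "{n. e \<le> norm (if n = m then 1 else 0 :: 'k)} \<in> I" if "e > 0" for e
  proof -
    have "finite {n. e \<le> norm (if n = m then 1 else 0 :: 'k)}"
      by (rule finite_subset[of _ "{m}"]) (use that in \<open>auto split: if_splits\<close>)
    then show ?thesis using I by (simp add: omega_ideal_def)
  qed
  moreover have "bounded (range (unit_seq m :: nat \<Rightarrow> 'k))"
    by (auto simp: bounded_iff intro!: exI[of _ 1])
  ultimately show ?thesis by (simp add: c0_ideal_def)
qed

lemma bounded_operator_linf_add:
  assumes "bounded_operator (restr linf V) (restr linf W) T" "x \<in> V" "y \<in> V"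
  shows "T (\<lambda>n. x n + y n) = (\<lambda>n. T x n + T y n)"
  using assms by (simp add: bounded_operator_def)

lemma bounded_operator_linf_mult:
  assumes "bounded_operator (restr linf V) (restr linf W) T" "x \<in> V"
  shows "T (\<lambda>n. a * x n) = (\<lambda>n. a * T x n)"
  using assms by (simp add: bounded_operator_def)

text \<open>The domain \<open>V\<close> is left general to cover both uses: all bounded sequences
  for projections, the convergent ones for extensions.\<close>

lemma op_norm_fixing_unit_seqs_ge_2:
  fixes V :: "(nat \<Rightarrow> 'k::real_normed_field) set"
  assumes I: "proper_ideal I" and V: "linf_subspace V"
    and one: "(\<lambda>n. 1) \<in> V" and e: "\<And>m. unit_seq m \<in> V"
    and T: "bounded_operator (restr linf V) (restr linf (c0_ideal I)) T"
    and Te: "\<And>m. T (unit_seq m) = unit_seq m"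
  shows "op_norm (restr linf V) (restr linf (c0_ideal I)) T \<ge> 2"
proof (rule field_le_epsilon)
  fix \<epsilon> :: real assume \<epsilon>: "\<epsilon> > 0"
  have T_in: "T x \<in> c0_ideal I" if "x \<in> V" for x
    using T that by (auto simp: bounded_operator_def)
  have "{n. \<epsilon> \<le> norm (T (\<lambda>n. 1) n)} \<in> I" using T_in[OF one] \<epsilon> by (rule c0_idealD)
  moreover have "UNIV \<notin> I" using I by (auto simp: proper_ideal_def omega_ideal_def)
  ultimately have "{n. \<epsilon> \<le> norm (T (\<lambda>n. 1) n)} \<noteq> UNIV" by metis
  then obtain m where m: "norm (T (\<lambda>n. 1) m) < \<epsilon>"
    by (metis (mono_tags, lifting) UNIV_eq_I mem_Collect_eq not_le)
  define x :: "nat \<Rightarrow> 'k" where "x = (\<lambda>n. 1 + - 2 * unit_seq m n)"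
  have e': "(\<lambda>n. - 2 * unit_seq m n) \<in> V" using linf_subspace_mult[OF V e] .
  have x: "x \<in> V" unfolding x_def using linf_subspace_add[OF V one e'] .
  have nx: "vnorm linf x \<le> 1" by (rule vnorm_linf_le) (auto simp: x_def)
  have "T x = (\<lambda>n. T (\<lambda>n. 1) n + T (\<lambda>n. - 2 * unit_seq m n) n)"
    unfolding x_def by (rule bounded_operator_linf_add[OF T one e'])
  moreover have "T (\<lambda>n. - 2 * unit_seq m n) = (\<lambda>n. - 2 * T (unit_seq m) n)"
    by (rule bounded_operator_linf_mult[OF T e])
  ultimately have "T x m = T (\<lambda>n. 1) m - 2" by (simp add: Te)
  then have "2 - \<epsilon> \<le> norm (T x m)"
    using m norm_triangle_ineq2[of 2 "T (\<lambda>n. 1) m"] by (simp add: norm_minus_commute)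
  also have "\<dots> \<le> vnorm linf (T x)"
    using T_in[OF x] by (intro norm_le_vnorm_linf) (simp add: c0_ideal_def)
  also have "\<dots> \<le> op_norm (restr linf V) (restr linf (c0_ideal I)) T"
    unfolding op_norm_def
  proof (rule cSup_upper)
    show "vnorm linf (T x) \<in> {vnorm (restr linf (c0_ideal I)) (T x) |x.
        x \<in> vcar (restr linf V) \<and> vnorm (restr linf V) x \<le> 1}"
      using x nx by auto
    \<comment> \<open>\<open>op_norm\<close> is a real supremum, so the set must be shown bounded
      above. The constant of the operator does this, in absolute value because \<open>C\<close> may
      be negative.\<close>
    obtain C where C: "\<And>x. x \<in> V \<Longrightarrow> vnorm linf (T x) \<le> C * vnorm linf x"
      using T unfolding bounded_operator_def by simp blast
    have "vnorm linf (T x) \<le> \<bar>C\<bar>" if "x \<in> V" "vnorm linf x \<le> 1" for x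
    proof -
      have "0 \<le> vnorm linf x"
        using norm_le_vnorm_linf[OF linf_subspace_bounded[OF V that(1)], of 0] norm_ge_zero[of "x 0"]
        by linarith
      then have "C * vnorm linf x \<le> \<bar>C\<bar> * 1" using that(2) by (intro mult_mono) auto
      then show ?thesis using C[OF that(1)] by simp
    qed
    then show "bdd_above {vnorm (restr linf (c0_ideal I)) (T x) |x.
        x \<in> vcar (restr linf V) \<and> vnorm (restr linf V) x \<le> 1}"
      by (auto simp: bdd_above_def)
  qed
  finally show "2 \<le> op_norm (restr linf V) (restr linf (c0_ideal I)) T + \<epsilon>" by simp
qed

section \<open>The complementation constant\<close>

lemma projection_onto_fixes:
  assumes "projection_onto Y P" "y \<in> Y"
  shows "P y = y"
proof -
  have "y \<in> P ` vcar linf" using assms by (simp add: projection_onto_def)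
  then obtain x where "x \<in> vcar linf" "y = P x" by blast
  then show ?thesis using assms(1) by (simp add: projection_onto_def)
qed

lemma comp_const_c0_ideal_ge_2:
  assumes I: "proper_ideal I"
  shows "comp_const (c0_ideal I :: (nat \<Rightarrow> 'k::real_normed_field) set) \<ge> 2"
  unfolding comp_const_def
\<comment> \<open>The infimum lives in \<open>ereal\<close>, so bounding each member suffices even
  when there is no projection.\<close>
proof (rule Inf_greatest, clarify)
  fix P :: "(nat \<Rightarrow> 'k) \<Rightarrow> nat \<Rightarrow> 'k" assume P: "projection_onto (c0_ideal I) P"
  have oI: "omega_ideal I" using I by (simp add: proper_ideal_def)
  \<comment> \<open>Writing \<open>linf\<close> as a restriction to its own carrier makes the
    general lemma applicable.\<close>
  have r: "restr linf {x :: nat \<Rightarrow> 'k. bounded (range x)} = linf" by (simp add: linf_def)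
  have e: "unit_seq m \<in> c0_ideal I" for m
    using oI by (rule unit_seq_in_c0_ideal)
  have "2 \<le> op_norm (restr linf {x :: nat \<Rightarrow> 'k. bounded (range x)}) (restr linf (c0_ideal I)) P"
  proof (rule op_norm_fixing_unit_seqs_ge_2[OF I linf_subspace_bounded_seqs])
    show "bounded_operator (restr linf {x. bounded (range x)}) (restr linf (c0_ideal I)) P"
      using P unfolding r projection_onto_def by blast
    show "P (unit_seq m) = unit_seq m" for m using P e by (rule projection_onto_fixes)
    show "unit_seq m \<in> {x :: nat \<Rightarrow> 'k. bounded (range x)}" for m
      using oI linf_subspace_bounded[OF linf_subspace_c0_ideal e[of m]]
      by (intro CollectI) blast
  qed auto
  then show "2 \<le> ereal (op_norm linf (restr linf (c0_ideal I)) P)"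
    unfolding r by simp
qed

section \<open>The space of convergent sequences\<close>

definition convergent_seqs :: "(nat \<Rightarrow> 'k::real_normed_field) set" where
  "convergent_seqs = {x. convergent x}"

text \<open>This rests on completeness of the scalar field; the Cauchy form allows tail estimates
  without naming a limit.\<close>

lemma convergent_seqs_iff_Cauchy: "x \<in> convergent_seqs \<longleftrightarrow> Cauchy (x :: nat \<Rightarrow> 'k::real_normed_field)"
  using complete_real_normed_field[where 'a = 'k]
  by (auto simp: convergent_seqs_def complete_def convergent_def intro: LIMSEQ_imp_Cauchy)

lemma linf_subspace_convergent_seqs: "linf_subspace (convergent_seqs :: (nat \<Rightarrow> 'k::real_normed_field) set)"
  unfolding linf_subspace_def convergent_seqs_def
  by (simp add: subset_eq convergent_Cauchy cauchy_imp_bounded convergent_add convergent_const convergent_mult)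

text \<open>Used to show that a uniform limit of convergent sequences converges.\<close>

lemma uniform_limit_Cauchy:
  assumes "\<And>e. e > 0 \<Longrightarrow> \<exists>y. Cauchy y \<and> (\<forall>n. norm (x n - y n) \<le> e)"
  shows "Cauchy (x :: nat \<Rightarrow> 'k::real_normed_field)"
proof (rule metric_CauchyI)
  fix e :: real assume "e > 0"
  then obtain y where y: "Cauchy y" "\<And>n. norm (x n - y n) \<le> e / 4" using assms[of "e / 4"] by auto
  obtain N where N: "\<And>m n. m \<ge> N \<Longrightarrow> n \<ge> N \<Longrightarrow> dist (y m) (y n) < e / 4"
    using metric_CauchyD[OF y(1), of "e / 4"] \<open>e > 0\<close> by auto
  have "dist (x m) (x n) < e" if "m \<ge> N" "n \<ge> N" for m n
  proof -
    have "dist (x m) (y m) \<le> e / 4" "dist (y n) (x n) \<le> e / 4"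
      using y(2)[of m] y(2)[of n] by (simp_all add: dist_norm norm_minus_commute)
    moreover have "dist (x m) (x n) \<le> dist (x m) (y m) + dist (y m) (y n) + dist (y n) (x n)"
      by (meson add_mono_thms_linordered_semiring(3) dist_triangle order_trans)
    ultimately show ?thesis using N[OF that] \<open>e > 0\<close> by simp
  qed
  then show "\<exists>N. \<forall>m\<ge>N. \<forall>n\<ge>N. dist (x m) (x n) < e" by blast
qed

text \<open>Completeness: coordinatewise limits exist, and the Cauchy estimate makes the convergence
  uniform. Separability: the eventually constant sequences with values in a countable dense set of
  scalars are dense.\<close>

lemma separable_banach_space_convergent_seqs:
  "separable_banach_space (restr linf (convergent_seqs :: (nat \<Rightarrow> 'k::real_normed_field) set))"
proof -
  let ?V = "convergent_seqs :: (nat \<Rightarrow> 'k) set"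
  let ?d = "vdist (restr linf ?V)"
  note V = linf_subspace_convergent_seqs
  interpret E: normed_space "restr linf ?V" using V by (rule normed_space_linf_subspace)
  interpret M: Metric_space ?V ?d using E.Metric_space_vdist by simp
  have dist_le: "?d x y \<le> r" if "x \<in> ?V" "y \<in> ?V" "\<And>n. norm (x n - y n) \<le> r" for x y r
    using that by (simp add: vdist_linf_subspace vnorm_linf_le)
  have le_dist: "norm (x n - y n) \<le> ?d x y" if "x \<in> ?V" "y \<in> ?V" for x y n
    using V that by (rule norm_le_vdist_linf)
  have "M.mcomplete"
    unfolding M.mcomplete_def
  proof (intro allI impI)
    fix \<sigma> assume C: "M.MCauchy \<sigma>"
    have \<sigma>: "\<sigma> k \<in> ?V" for k using C by (auto simp: M.MCauchy_def)
    have C': "\<exists>N. \<forall>k k'. N \<le> k \<longrightarrow> N \<le> k' \<longrightarrow> ?d (\<sigma> k) (\<sigma> k') < e" if "e > 0" for e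
      using C that by (auto simp: M.MCauchy_def)
    have "\<exists>l. (\<lambda>k. \<sigma> k n) \<longlonglongrightarrow> l" for n
    proof -
      have "Cauchy (\<lambda>k. \<sigma> k n)"
      proof (rule metric_CauchyI)
        fix e :: real assume "e > 0"
        then show "\<exists>N. \<forall>k\<ge>N. \<forall>k'\<ge>N. dist (\<sigma> k n) (\<sigma> k' n) < e"
          using C'[of e] le_dist[OF \<sigma> \<sigma>] unfolding dist_norm by (meson le_less_trans)
      qed
      then show ?thesis using complete_real_normed_field unfolding complete_def by blast
    qed
    then obtain x where x: "\<And>n. (\<lambda>k. \<sigma> k n) \<longlonglongrightarrow> x n" by metis
    \<comment> \<open>Letting \<open>k'\<close> tend to infinity in the Cauchy estimate gives a
      threshold independent of the coordinate \<open>n\<close>.\<close>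
    have near: "\<exists>N. \<forall>k\<ge>N. \<forall>n. norm (\<sigma> k n - x n) \<le> e" if "e > 0" for e
    proof -
      obtain N where N: "\<And>k k'. N \<le> k \<Longrightarrow> N \<le> k' \<Longrightarrow> ?d (\<sigma> k) (\<sigma> k') < e" using C' \<open>e > 0\<close> by blast
      have "norm (\<sigma> k n - x n) \<le> e" if "k \<ge> N" for k n
      proof (rule LIMSEQ_le_const2)
        show "(\<lambda>k'. norm (\<sigma> k n - \<sigma> k' n)) \<longlonglongrightarrow> norm (\<sigma> k n - x n)" using x by (intro tendsto_intros)
        show "\<exists>N. \<forall>k'\<ge>N. norm (\<sigma> k n - \<sigma> k' n) \<le> e"
          using N[OF that] le_dist[OF \<sigma> \<sigma>] by (meson less_imp_le order_trans)
      qed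
      then show ?thesis by blast
    qed
    have "Cauchy x"
    proof (rule uniform_limit_Cauchy)
      fix e :: real assume "e > 0"
      then obtain N where "\<forall>n. norm (\<sigma> N n - x n) \<le> e" using near by blast
      then show "\<exists>y. Cauchy y \<and> (\<forall>n. norm (x n - y n) \<le> e)"
        using \<sigma>[of N] by (intro exI[of _ "\<sigma> N"]) (simp add: convergent_seqs_iff_Cauchy norm_minus_commute)
    qed
    then have xV: "x \<in> ?V" by (simp add: convergent_seqs_iff_Cauchy)
    have "limitin M.mtopology \<sigma> x sequentially"
      unfolding M.limit_metric_sequentially
    proof (intro conjI allI impI)
      fix e :: real assume e: "e > 0"
      then obtain N where "\<forall>k\<ge>N. \<forall>n. norm (\<sigma> k n - x n) \<le> e / 2" using near[of "e / 2"] by auto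
      then have "\<forall>k\<ge>N. ?d (\<sigma> k) x \<le> e / 2" using dist_le[OF \<sigma> xV] by blast
      then show "\<exists>N. \<forall>k\<ge>N. \<sigma> k \<in> ?V \<and> ?d (\<sigma> k) x < e" using \<sigma> e by force
    qed (rule xV)
    then show "\<exists>x. limitin M.mtopology \<sigma> x sequentially" by blast
  qed
  moreover have "separable_space M.mtopology"
  proof -
    obtain D :: "'k set" where D: "countable D" "\<And>x e. e > 0 \<Longrightarrow> \<exists>y\<in>D. norm (x - y) < e"
      using separable_real_normed_field by blast
    \<comment> \<open>A finite list of initial entries followed by a constant tail.\<close>
    define s :: "'k list \<times> 'k \<Rightarrow> nat \<Rightarrow> 'k" where
      "s = (\<lambda>(xs, d) n. if n < length xs then xs ! n else d)"
    define S where "S = s ` (lists D \<times> D)"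
    have sV: "s z \<in> ?V" for z
    proof -
      obtain xs d where z: "z = (xs, d)" by fastforce
      have "eventually (\<lambda>n. s z n = d) sequentially"
        unfolding eventually_sequentially by (auto simp: s_def z intro!: exI[of _ "length xs"])
      then have "s z \<longlonglongrightarrow> d" by (rule tendsto_eventually)
      then show ?thesis by (auto simp: convergent_seqs_def convergent_def)
    qed
    have "countable S" unfolding S_def using D(1) by (intro countable_image countable_SIGMA) auto
    moreover have "S \<subseteq> ?V" unfolding S_def using sV by blast
    moreover have "\<exists>y\<in>S. y \<in> M.mball x r" if x: "x \<in> ?V" and r: "r > 0" for x r
    proof -
      obtain N where N: "\<And>n. n \<ge> N \<Longrightarrow> dist (x n) (x N) < r / 4"
        using x r metric_CauchyD[of x "r / 4"] by (auto simp: convergent_seqs_iff_Cauchy)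
      obtain p where p: "\<And>z. p z \<in> D" "\<And>z. norm (z - p z) < r / 4"
        using D(2)[of "r / 4"] r by (metis divide_pos_pos zero_less_numeral)
      \<comment> \<open>The first \<open>N\<close> entries of \<open>x\<close> are approximated one
        by one and the tail through \<open>x N\<close>, with tail error below
        \<open>r / 4 + r / 4\<close>.\<close>
      define y where "y = s (map (\<lambda>n. p (x n)) [0..<N], p (x N))"
      have "norm (x n - y n) \<le> r / 2" for n
      proof (cases "n < N")
        case True
        then show ?thesis using p(2)[of "x n"] r by (simp add: y_def s_def)
      next
        case False
        then have "norm (x n - x N) < r / 4" using N[of n] by (simp add: dist_norm)
        moreover have "norm (x n - p (x N)) \<le> norm (x n - x N) + norm (x N - p (x N))"
          by (rule norm_triangle_ineq[of "x n - x N" "x N - p (x N)", simplified])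
        ultimately show ?thesis using p(2)[of "x N"] False by (simp add: y_def s_def)
      qed
      then have "?d x y \<le> r / 2" using x sV unfolding y_def by (intro dist_le)
      moreover have "y \<in> S" unfolding y_def S_def using p(1) by (intro imageI) auto
      ultimately show ?thesis using x r sV by (intro bexI[of _ y]) (auto simp: y_def)
    qed
    ultimately show ?thesis
      unfolding separable_space_def by (intro exI[of _ S]) (auto simp: M.metric_closure_of)
  qed
  ultimately show ?thesis
    by (simp add: separable_banach_space_def banach_space_def vtopology_def E.normed_space_axioms)
qed

text \<open>For a proper ideal the intersection is the space of null sequences, as a nonzero limit
  would put a cofinite set into the ideal. Closedness: if \<open>y\<close> is within
  \<open>e / 2\<close> of \<open>x\<close>, then \<open>x\<close> can reach size \<open>e\<close>
  only where \<open>y\<close> reaches \<open>e / 2\<close>.\<close>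

lemma closed_subspace_convergent_c0_ideal:
  assumes I: "omega_ideal I"
  shows "closed_subspace (restr linf (convergent_seqs :: (nat \<Rightarrow> 'k::real_normed_field) set))
           (convergent_seqs \<inter> c0_ideal I)"
proof -
  let ?V = "convergent_seqs :: (nat \<Rightarrow> 'k) set"
  let ?d = "vdist (restr linf ?V)"
  note V = linf_subspace_convergent_seqs
  interpret E: normed_space "restr linf ?V" using V by (rule normed_space_linf_subspace)
  interpret M: Metric_space ?V ?d using E.Metric_space_vdist by simp
  have "M.mtopology closure_of (?V \<inter> c0_ideal I) \<subseteq> ?V \<inter> c0_ideal I"
  proof
    fix x assume "x \<in> M.mtopology closure_of (?V \<inter> c0_ideal I)"
    then have x: "x \<in> ?V" and near: "\<And>r. r > 0 \<Longrightarrow> \<exists>y\<in>?V \<inter> c0_ideal I. y \<in> M.mball x r"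
      by (auto simp: M.metric_closure_of)
    have "{n. e \<le> norm (x n)} \<in> I" if e: "e > 0" for e
    proof -
      obtain y where y: "y \<in> ?V" "y \<in> c0_ideal I" "?d x y < e / 2"
        using near[of "e / 2"] e by (auto simp: M.in_mball)
      have "norm (x n - y n) < e / 2" for n
        using norm_le_vdist_linf[OF V x y(1), of n] y(3) by linarith
      then have "{n. e \<le> norm (x n)} \<subseteq> {n. e / 2 \<le> norm (y n)}"
        using norm_triangle_ineq2[of "x n" "y n" for n] by (smt (verit) Collect_mono field_sum_of_halves)
      moreover have "{n. e / 2 \<le> norm (y n)} \<in> I" using y(2) e by (intro c0_idealD) auto
      ultimately show ?thesis using I by (auto simp: omega_ideal_def)
    qed
    then show "x \<in> ?V \<inter> c0_ideal I"
      using x linf_subspace_bounded[OF V x] by (simp add: c0_ideal_def)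
  qed
  then have "closedin M.mtopology (?V \<inter> c0_ideal I)"
    by (simp add: closure_of_subset_eq[symmetric])
  moreover have "linf_subspace (?V \<inter> c0_ideal I)"
    using V linf_subspace_c0_ideal[OF I] by (rule linf_subspace_Int)
  ultimately show ?thesis
    by (simp add: closed_subspace_def linf_subspace_def vtopology_def)
qed

section \<open>The separable-injectivity constant\<close>

lemma op_norm_inclusion_le_1:
  assumes "linf_subspace F"
  shows "op_norm (restr linf F) (restr linf Y) (\<lambda>x. x) \<le> 1"
  unfolding op_norm_def
proof (rule cSup_least)
  have "vnorm linf (\<lambda>n. 0 :: 'a) \<le> 1" by (rule vnorm_linf_le) simp
  then show "{vnorm (restr linf Y) x |x. x \<in> vcar (restr linf F) \<and> vnorm (restr linf F) x \<le> 1} \<noteq> {}"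
    using assms by (auto simp: linf_subspace_def)
qed auto

lemma si_const_c0_ideal_ge_2:
  assumes I: "proper_ideal I"
  shows "si_const (restr linf (c0_ideal I :: (nat \<Rightarrow> 'k::real_normed_field) set)) \<ge> 2"
  unfolding si_const_def
proof (rule Inf_greatest, clarify)
  fix l :: real
  let ?V = "convergent_seqs :: (nat \<Rightarrow> 'k) set"
  let ?Y = "c0_ideal I :: (nat \<Rightarrow> 'k) set"
  let ?F = "?V \<inter> ?Y"
  assume l: "l > 0" and "\<forall>E :: ('k, nat \<Rightarrow> 'k) nvs.
    separable_banach_space E \<longrightarrow> extends_into (restr linf ?Y) l E"
  then have ext: "extends_into (restr linf ?Y) l (restr linf ?V)"
    using separable_banach_space_convergent_seqs by blast
  have oI: "omega_ideal I" using I by (simp add: proper_ideal_def)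
  have F: "linf_subspace ?F"
    using linf_subspace_convergent_seqs linf_subspace_c0_ideal[OF oI] by (rule linf_subspace_Int)
  have "bounded_operator (restr (restr linf ?V) ?F) (restr linf ?Y) (\<lambda>x. x)"
    unfolding bounded_operator_def by (auto intro: exI[of _ 1])
  then obtain T where T: "bounded_operator (restr linf ?V) (restr linf ?Y) T" "\<forall>x\<in>?F. T x = x"
    and "op_norm (restr linf ?V) (restr linf ?Y) T
      \<le> l * op_norm (restr (restr linf ?V) ?F) (restr linf ?Y) (\<lambda>x. x)"
    using ext closed_subspace_convergent_c0_ideal[OF oI] unfolding extends_into_def by blast
  moreover have "op_norm (restr (restr linf ?V) ?F) (restr linf ?Y) (\<lambda>x. x) \<le> 1"
    using op_norm_inclusion_le_1[OF F] by simp
  \<comment> \<open>Since \<open>l\<close> is positive, the bound 1 for the inclusion turns into the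
    bound \<open>l\<close> for its extension.\<close>
  ultimately have "op_norm (restr linf ?V) (restr linf ?Y) T \<le> l"
    using l mult_left_le[of _ l] by (meson less_imp_le order_trans)
  moreover have "op_norm (restr linf ?V) (restr linf ?Y) T \<ge> 2"
  proof (rule op_norm_fixing_unit_seqs_ge_2[OF I linf_subspace_convergent_seqs _ _ T(1)])
    show "(\<lambda>n. 1) \<in> ?V" by (simp add: convergent_seqs_def convergent_const)
    show e: "unit_seq m \<in> ?V" for m
    proof -
      have "eventually (\<lambda>n. unit_seq m n = (0 :: 'k)) sequentially"
        unfolding eventually_sequentially by (auto intro!: exI[of _ "Suc m"])
      then have "unit_seq m \<longlonglongrightarrow> (0 :: 'k)" by (rule tendsto_eventually)
      then show ?thesis by (auto simp: convergent_seqs_def convergent_def)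
    qed
    \<comment> \<open>The unit sequences lie in \<open>?F\<close>, where the extension agrees with
      the inclusion.\<close>
    show "T (unit_seq m) = unit_seq m" for m
      using T(2) e unit_seq_in_c0_ideal[OF oI] by blast
  qed
  ultimately show "2 \<le> ereal l" by simp
qed

theorem corollary5p9:
  fixes I :: "nat set set"
  assumes "proper_ideal I"
  shows "comp_const (c0_ideal I :: (nat \<Rightarrow> 'k::real_normed_field) set) \<ge> 2 \<and>
    si_const (restr linf (c0_ideal I :: (nat \<Rightarrow> 'k) set)) \<ge> 2"
  using assms by (intro conjI comp_const_c0_ideal_ge_2 si_const_c0_ideal_ge_2)

end
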